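(* Consider a cascading bandit with ground set $E=\{1,\dots,L\}$, $K\le L$ recommended items and attraction probabilities $\bar w\in[0,1]^E$, satisfying the standing assumptions in the context. Let $R(n)$ be the expected $n$-step regret of the algorithm $\mathtt{CascadeUCB1}$ defined in the context. Then for every $n\ge 1$, $$R(n)\;\le\;\sum_{e=K+1}^{L}\frac{12}{\Delta_{e,K}}\log n+\frac{\pi^2}{3}L .$$
   Context: **Cascading bandit.** $E=\{1,\dots,L\}$ is a ground set of $L$ items, $1\le K\le L$, and $\Pi_K(E)$ is the set of $K$-permutations of $E$ (ordered lists of $K$ distinct items). $P$ is a distribution on $\{0,1\}^E$ that is a product of Bernoulli distributions, the coordinate $e$ having mean $\bar w(e)\in[0,1]$. The weights $\mathbf w_0,\mathbf w_1,\mathbf w_2,\dots$ are i.i.d. from $P$. At each time $t=1,\dots,n$ the agent recommends a list $\mathbf A_t=(\mathbf a^t_1,\dots,\mathbf a^t_K)\in\Pi_K(E)$, computed from its observations before time $t$, and then observes the click $\mathbf C_t=\min\{1\le k\le K:\mathbf w_t(\mathbf a^t_k)=1\}$, with $\min\emptyset=\infty$. Item $e$ is *observed* at time $t$ if $e=\mathbf a^t_k$ for some $1\le k\le\min\{\mathbf C_t,K\}$; in this case its weight is known to be $\mathbf w_t(\mathbf a^t_k)=\mathbf 1\{\mathbf C_t=k\}$. **Regret.** For $A=(a_1,\dots,a_K)$ and $w\in[0,1]^E$ let $f(A,w)=1-\prod_{k=1}^K(1-w(a_k))$. Let $A^\ast\in\arg\max_{A\in\Pi_K(E)}f(A,\bar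 w)$ and $R(A,w)=f(A^\ast,w)-f(A,w)$. The expected $n$-step regret is $R(n)=\mathbb E\big[\sum_{t=1}^nR(\mathbf A_t,\mathbf w_t)\big]$. **Standing assumptions.** Items are numbered so that $\bar w(1)\ge\dots\ge\bar w(L)$, so $A^\ast=(1,\dots,K)$; the optimal solution is unique as a set (hence $\bar w(K)>\bar w(K+1)$ if $K<L$). For $e>K$ and $e^\ast\le K$, $\Delta_{e,e^\ast}=\bar w(e^\ast)-\bar w(e)$. **Algorithm $\mathtt{CascadeUCB1}$.** Initially $\mathbf w_0$ is observed, which gives one observed weight of every item: $\mathbf T_0(e)=1$ and $\hat{\mathbf w}_1(e)=\mathbf w_0(e)$ (this initialization is not counted in the regret). $\mathbf T_t(e)$ is $1$ plus the number of times in $\{1,\dots,t\}$ at which item $e$ is observed, and $\hat{\mathbf w}_s(e)$ is the average of the first $s$ observed weights of item $e$. At time $t$ the algorithm computes $$\mathbf U_t(e)=\hat{\mathbf w}_{\mathbf T_{t-1}(e)}(e)+c_{t-1,\mathbf T_{t-1}(e)},\qquad c_{t,s}=\sqrt{(1.5\log t)/s},$$ with the convention $c_{0,s}=0$, and recommends as $\mathbf A_t$ a list of $K$ items with the largest values of $\mathbf U_t$ (ties broken arbitrarily, items in the list ordered arbitrarily, as a function of past observations). *)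

theory Defs
  imports "HOL-Probability.Probability"
begin

text \<open>
  Items are the natural numbers \<open>1, \<dots>, L\<close>; a binary weight vector is a function on items.
\<close>

type_synonym weights = "nat \<Rightarrow> bool"

definition perms :: "nat \<Rightarrow> nat \<Rightarrow> nat list set" where
  "perms L K = {A. length A = K \<and> distinct A \<and> set A \<subseteq> {1..L}}"

text \<open>Elements of the underlying space are extensional, i.e. \<open>undefined\<close> outside \<open>{1..L}\<close>.\<close>

definition weight_dist :: "nat \<Rightarrow> (nat \<Rightarrow> real) \<Rightarrow> weights measure" where
  "weight_dist L wbar = PiM {1..L} (\<lambda>e. measure_pmf (bernoulli_pmf (wbar e)))"

definition reward :: "nat list \<Rightarrow> (nat \<Rightarrow> real) \<Rightarrow> real" where
  "reward A w = 1 - (\<Prod>a\<leftarrow>A. 1 - w a)"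

text \<open>Positions in a list are counted from 1. The infimum of the empty set in \<open>enat\<close> is \<open>\<infinity>\<close>.\<close>

definition click :: "nat list \<Rightarrow> weights \<Rightarrow> enat" where
  "click A w = Inf (enat ` {k \<in> {1..length A}. w (A ! (k - 1))})"

text \<open>
  What the agent sees in one step: the recommended list and the click. A history consists of the
  initially observed weight vector and the observations of steps \<open>1, 2, \<dots>\<close> in chronological order.
  A policy maps the history before a step to the list recommended in that step.
\<close>

type_synonym observation = "nat list \<times> enat"
type_synonym history = "weights \<times> observation list"
type_synonym policy = "history \<Rightarrow> nat list"

fun observed :: "nat \<Rightarrow> observation \<Rightarrow> bool" where
  "observed e (A, C) \<longleftrightarrow>
     (\<exists>k\<in>{1..length A}. e = A ! (k - 1) \<and> enat k \<le> min C (enat (length A)))"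

text \<open>
  The weight revealed by a step in which \<open>e\<close> is observed: 1 if the click is at the (unique)
  position of \<open>e\<close>, and 0 otherwise.
\<close>

fun revealed_weight :: "nat \<Rightarrow> observation \<Rightarrow> real" where
  "revealed_weight e (A, C) = of_bool (\<exists>k\<in>{1..length A}. e = A ! (k - 1) \<and> C = enat k)"

definition obs_count :: "history \<Rightarrow> nat \<Rightarrow> nat" where
  "obs_count h e = 1 + length (filter (observed e) (snd h))"

definition observed_weights :: "history \<Rightarrow> nat \<Rightarrow> real list" where
  "observed_weights h e =
     of_bool (fst h e) # map (revealed_weight e) (filter (observed e) (snd h))"

definition mean_weight :: "history \<Rightarrow> nat \<Rightarrow> nat \<Rightarrow> real" where
  "mean_weight h s e = sum_list (take s (observed_weights h e)) / real s"

definition conf_radius :: "nat \<Rightarrow> nat \<Rightarrow> real" where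
  "conf_radius t s = (if t = 0 then 0 else sqrt (1.5 * ln (real t) / real s))"

text \<open>A history before step \<open>t\<close> contains the observations of \<open>t - 1\<close> steps.\<close>

definition ucb :: "history \<Rightarrow> nat \<Rightarrow> real" where
  "ucb h e = mean_weight h (obs_count h e) e + conf_radius (length (snd h)) (obs_count h e)"

text \<open>
  Any choice of \<open>K\<close> items with the largest upper confidence bounds, in any order, is admissible;
  ties and order are resolved by the policy as a function of the history.
\<close>

definition cascade_ucb1 :: "nat \<Rightarrow> nat \<Rightarrow> policy \<Rightarrow> bool" where
  "cascade_ucb1 L K \<pi> \<longleftrightarrow>
     (\<forall>h. \<pi> h \<in> perms L K \<and>
          (\<forall>e\<in>set (\<pi> h). \<forall>e'\<in>{1..L} - set (\<pi> h). ucb h e' \<le> ucb h e))"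

text \<open>
  The observations of the first \<open>t\<close> steps when \<open>\<pi>\<close> is run on a weight sequence \<open>w\<close>
  with \<open>w 0\<close> observed initially.
\<close>

fun observations :: "policy \<Rightarrow> (nat \<Rightarrow> weights) \<Rightarrow> nat \<Rightarrow> observation list" where
  "observations \<pi> w 0 = []"
| "observations \<pi> w (Suc t) =
     (let A = \<pi> (w 0, observations \<pi> w t)
      in observations \<pi> w t @ [(A, click A (w (Suc t)))])"

definition action :: "policy \<Rightarrow> (nat \<Rightarrow> weights) \<Rightarrow> nat \<Rightarrow> nat list" where
  "action \<pi> w t = \<pi> (w 0, observations \<pi> w (t - 1))"

definition step_regret :: "nat list \<Rightarrow> nat list \<Rightarrow> (nat \<Rightarrow> real) \<Rightarrow> real" where
  "step_regret Astar A w = reward Astar w - reward A w"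

definition expected_regret ::
  "'a measure \<Rightarrow> (nat \<Rightarrow> 'a \<Rightarrow> weights) \<Rightarrow> policy \<Rightarrow> nat list \<Rightarrow> nat \<Rightarrow> real" where
  "expected_regret M w \<pi> Astar n =
     (\<integral>\<omega>. (\<Sum>t=1..n. step_regret Astar (action \<pi> (\<lambda>s. w s \<omega>) t) (\<lambda>e. of_bool (w t \<omega> e))) \<partial>M)"

definition gap :: "(nat \<Rightarrow> real) \<Rightarrow> nat \<Rightarrow> nat \<Rightarrow> real" where
  "gap wbar e estar = wbar estar - wbar e"

end

theory Submission
  imports Defs
begin

text \<open>
  Call a history reliable if no optimal item is underestimated and no suboptimal item overestimated
  by more than its confidence radius. Since the event that an item is observed is independent of its
  own weight in that step, an exponential supermartingale stopped at each possible number of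
  observations bounds the probability of an unreliable history at time \<open>t\<close> by \<open>L (t + 1) / t\<^sup>3\<close>;
  the first two steps are simply charged 1 each.

  After a reliable history, a recommended suboptimal item \<open>e\<close> with \<open>s\<close> observations has a gap of at most
  \<open>sqrt (6 ln n / s)\<close> to every optimal item it displaces, which also forces
  \<open>s \<le> 6 ln n / \<Delta>\<^sup>2\<close> with \<open>\<Delta> = \<Delta>\<^bsub>e,K\<^esub>\<close>.
  The expected regret of the step is at most the sum of these gaps weighted by the probabilities of
  observing the items, so every observation of \<open>e\<close> is charged once for each value of \<open>s\<close>, and
  \<open>\<Sum>\<^sub>s 1 / sqrt s \<le> 2 sqrt (6 ln n) / \<Delta>\<close> gives \<open>12 ln n / \<Delta>\<close>.
\<close>

subsection \<open>Analytic and measure-theoretic estimates\<close>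

text \<open>Hoeffding's lemma for a centred variable with range of length 1, written out as a
  two-point expectation.\<close>

lemma hoeffding_bernoulli:
  fixes p l :: real
  assumes p: "0 \<le> p" "p \<le> 1"
  shows "p * exp (l * (1 - p)) + (1 - p) * exp (l * (0 - p)) \<le> exp (l\<^sup>2 / 8)"
proof -
  have pos: "p * exp (l * (1 - p)) + (1 - p) * exp (l * (0 - p)) \<le> exp (l\<^sup>2 / 8)"
    if p: "0 \<le> p" "p \<le> 1" and l: "l > 0" for p l :: real
  proof -
    interpret interval_bounded_random_variable "measure_pmf (bernoulli_pmf p)" "of_bool :: bool \<Rightarrow> real" 0 1
      by unfold_locales auto
    have "nn_integral (bernoulli_pmf p) (\<lambda>x. exp (l * (of_bool x - measure_pmf.expectation (bernoulli_pmf p) of_bool)))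
        \<le> ennreal (exp (l\<^sup>2 * (1 - 0)\<^sup>2 / 8))"
      by (rule Hoeffdings_lemma_nn_integral[OF l])
    then have "ennreal (exp (l * (1 - p))) * ennreal p + ennreal (exp (l * (0 - p))) * ennreal (1 - p)
        \<le> ennreal (exp (l\<^sup>2 / 8))"
      using p by (simp add: ennreal_minus flip: ennreal_1)
    then have "ennreal (exp (l * (1 - p)) * p + exp (l * (0 - p)) * (1 - p)) \<le> ennreal (exp (l\<^sup>2 / 8))"
      using p by (simp add: ennreal_plus ennreal_mult)
    then show ?thesis
      by (simp add: mult.commute)
  qed
  show ?thesis
  proof (cases "l = 0")
    case False
    then show ?thesis
      \<comment> \<open>Exchanging success and failure maps \<open>(p, l)\<close> to
        \<open>(1 - p, - l)\<close>, which reduces negative \<open>l\<close> to positive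
        \<open>l\<close>.\<close>
      using pos[OF p, of l] pos[of "1 - p" "- l"] p by (cases "l > 0") (auto simp: algebra_simps)
  qed simp
qed

text \<open>Every function on such a product is measurable, so later measurability obligations hold
  for arbitrary policies.\<close>

lemma sets_PiM_finite_discrete:
  assumes "finite I" and "\<And>i. i \<in> I \<Longrightarrow> finite (space (M i))"
    and "\<And>i. i \<in> I \<Longrightarrow> sets (M i) = Pow (space (M i))"
  shows "sets (PiM I M) = Pow (space (PiM I M))"
proof -
  \<comment> \<open>\<open>M\<close> is unconstrained outside \<open>I\<close>; the empty set there
    makes every \<open>B i\<close> countable and leaves the product unchanged.\<close>
  define B where "B i = (if i \<in> I then space (M i) else {})" for i
  have "sets (PiM I M) = sets (PiM I (\<lambda>i. count_space (B i)))"
    using assms by (intro sets_PiM_cong) (auto simp: B_def)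
  also have "\<dots> = Pow (PiE I B)"
    using assms by (subst count_space_PiM_finite) (auto simp: B_def countable_finite)
  also have "PiE I B = space (PiM I M)"
    by (auto simp: space_PiM B_def PiE_def Pi_def)
  finally show ?thesis .
qed

text \<open>On a finite discrete range every function is measurable and bounded.\<close>

lemma (in finite_measure) integrable_discrete_rv:
  fixes g :: "'b \<Rightarrow> real"
  assumes X: "X \<in> measurable M N" and fin: "finite (space N)" and sets: "sets N = Pow (space N)"
  shows "integrable M (\<lambda>\<omega>. g (X \<omega>))"
proof (rule integrable_const_bound)
  have "g \<in> borel_measurable N"
    by (auto simp: measurable_def sets)
  then show "(\<lambda>\<omega>. g (X \<omega>)) \<in> borel_measurable M"
    using X by (rule measurable_compose[rotated])
  show "AE \<omega> in M. norm (g (X \<omega>)) \<le> Max ((\<lambda>x. norm (g x)) ` space N)"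
    using fin measurable_space[OF X] by (intro AE_I2 Max_ge) auto
qed

text \<open>The counter \<open>T\<close> moves exactly when \<open>Q\<close> holds, so each value
  below \<open>T n\<close> is charged once. This trades a sum over time for a sum over numbers of
  observations.\<close>

lemma telescoping_cost:
  fixes \<phi> :: "nat \<Rightarrow> real" and T :: "nat \<Rightarrow> nat"
  assumes "T 0 = 1" and "\<And>t. t < n \<Longrightarrow> T (Suc t) = T t + of_bool (Q t)"
  shows "(\<Sum>t<n. of_bool (Q t) * \<phi> (T t)) = (\<Sum>s=1..<T n. \<phi> s)"
proof -
  have "T n \<ge> 1 \<and> (\<Sum>t<n. of_bool (Q t) * \<phi> (T t)) = (\<Sum>s=1..<T n. \<phi> s)"
    using assms(2)
  proof (induction n)
    case 0
    then show ?case using assms(1) by simp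
  next
    case (Suc n)
    then show ?case by (cases "Q n") auto
  qed
  then show ?thesis ..
qed

text \<open>Discrete form of the integral of \<open>1 / sqrt x\<close>: each summand is at most the
  increment \<open>2 * sqrt s - 2 * sqrt (s - 1)\<close>.\<close>

lemma sum_inverse_sqrt_le:
  fixes S :: real
  assumes "S \<ge> 0"
  shows "(\<Sum>s=1..<m. if real s \<le> S then 1 / sqrt (real s) else 0) \<le> 2 * sqrt S"
proof -
  have step: "2 * sqrt (real s - 1) + 1 / sqrt (real s) \<le> 2 * sqrt (real s)" if "s \<ge> 1" for s
  proof -
    define a b where "a = sqrt (real s - 1)" and "b = sqrt (real s)"
    have b: "b > 0" and "a\<^sup>2 = real s - 1" "b\<^sup>2 = real s"
      using that by (auto simp: a_def b_def)
    then have ab: "b\<^sup>2 - a\<^sup>2 = 1"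
      by simp
    \<comment> \<open>Given \<open>b\<^sup>2 - a\<^sup>2 = 1\<close>, this is
      \<open>(a - b)\<^sup>2 \<ge> 0\<close>.\<close>
    have "2 * a * b + 1 \<le> 2 * b * b"
      using ab sum_squares_ge_zero[of "a - b" 0] by (simp add: power2_eq_square algebra_simps)
    then have "2 * a + 1 / b \<le> 2 * b"
      using b by (simp add: field_simps)
    then show ?thesis
      by (simp add: a_def b_def)
  qed
  \<comment> \<open>The induction needs the sharper bound with \<open>m - 1\<close>, the last index
    summed, which the new term raises to \<open>m\<close>.\<close>
  have "(\<Sum>s=1..<m. if real s \<le> S then 1 / sqrt (real s) else 0) \<le> 2 * sqrt (min S (real (m - 1)))"
  proof (induction m)
    case 0
    show ?case using assms by simp
  next
    case (Suc m)
    show ?case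
    proof (cases "m \<ge> 1 \<and> real m \<le> S")
      case True
      then have "(\<Sum>s=1..<Suc m. if real s \<le> S then 1 / sqrt (real s) else 0)
          \<le> 2 * sqrt (real m - 1) + 1 / sqrt (real m)"
        using Suc.IH by (simp add: min_def of_nat_diff split: if_splits)
      also have "\<dots> \<le> 2 * sqrt (real m)"
        using True by (intro step) simp
      finally show ?thesis using True by simp
    next
      case False
      have "(\<Sum>s=1..<Suc m. if real s \<le> S then 1 / sqrt (real s) else 0)
          \<le> 2 * sqrt (min S (real (m - 1)))"
        using False Suc.IH by (cases "m = 0") auto
      also have "\<dots> \<le> 2 * sqrt (min S (real m))"
        by simp
      finally show ?thesis by simp
    qed
  qed
  also have "\<dots> \<le> 2 * sqrt S"
    by simp
  finally show ?thesis .
qed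

text \<open>From \<open>t \<ge> 2\<close> on, \<open>t + 1 \<le> 3 / 2 * t\<close>, which leaves the
  tail of the series of inverse squares. The resulting constant leaves room for the first two
  steps.\<close>

lemma sum_cubic_tail_le: "(\<Sum>t=2..<n. real (t + 1) / real t ^ 3) \<le> 3 / 2 * (pi\<^sup>2 / 6 - 1)"
proof -
  have "(\<Sum>t=2..<n. real (t + 1) / real t ^ 3) \<le> (\<Sum>t=2..<n. 3 / 2 * (1 / (real t)\<^sup>2))"
  proof (rule sum_mono)
    fix t assume "t \<in> {2..<n}"
    then have t: "real t \<ge> 2" by simp
    have "real (t + 1) / real t ^ 3 \<le> (3 / 2 * real t) / real t ^ 3"
      using t by (intro divide_right_mono) auto
    also have "\<dots> = 3 / 2 * (1 / (real t)\<^sup>2)"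
      using t by (simp add: power2_eq_square power3_eq_cube)
    finally show "real (t + 1) / real t ^ 3 \<le> 3 / 2 * (1 / (real t)\<^sup>2)" .
  qed
  also have "\<dots> = 3 / 2 * (\<Sum>t=2..<n. 1 / (real t)\<^sup>2)"
    by (simp add: sum_distrib_left)
  also have "(\<Sum>t=2..<n. 1 / (real t)\<^sup>2) \<le> pi\<^sup>2 / 6 - 1"
  proof -
    have "(\<lambda>i. 1 / (real i + 1)\<^sup>2) sums (pi\<^sup>2 / 6)"
      using inverse_squares_sums by (simp add: add.commute)
    then have "(\<Sum>i<Suc n. 1 / (real i + 1)\<^sup>2) \<le> pi\<^sup>2 / 6"
      using sum_le_suminf[of "\<lambda>i. 1 / (real i + 1)\<^sup>2" "{..<Suc n}"] sums_unique sums_summable by fastforce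
    moreover have "1 + (\<Sum>t=2..<Suc (Suc n). 1 / (real t)\<^sup>2) = (\<Sum>i<Suc n. 1 / (real i + 1)\<^sup>2)"
      by (induction n) (auto simp: add.commute numeral_2_eq_2)
    moreover have "(\<Sum>t=2..<n. 1 / (real t)\<^sup>2) \<le> (\<Sum>t=2..<Suc (Suc n). 1 / (real t)\<^sup>2)"
      by (intro sum_mono2) auto
    ultimately show ?thesis
      by linarith
  qed
  finally show ?thesis by simp
qed

subsection \<open>Weights and clicks\<close>

lemma space_weight_dist: "space (weight_dist L wbar) = PiE {1..L} (\<lambda>_. UNIV)"
  by (simp add: weight_dist_def space_PiM)

lemma finite_space_weight_dist: "finite (space (weight_dist L wbar))"
  by (simp add: space_weight_dist finite_PiE)

lemma sets_weight_dist: "sets (weight_dist L wbar) = Pow (space (weight_dist L wbar))"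
  unfolding weight_dist_def by (rule sets_PiM_finite_discrete) auto

lemma prob_space_weight_dist: "prob_space (weight_dist L wbar)"
  unfolding weight_dist_def by (rule prob_space_PiM) (rule measure_pmf.prob_space_axioms)

lemma integrable_weight_dist:
  fixes g :: "weights \<Rightarrow> real"
  shows "integrable (weight_dist L wbar) g"
proof -
  interpret prob_space "weight_dist L wbar" by (rule prob_space_weight_dist)
  show ?thesis
    using integrable_discrete_rv[of "\<lambda>x. x" "weight_dist L wbar" g] finite_space_weight_dist sets_weight_dist
    by simp
qed

lemma borel_measurable_weight_dist: "(g :: weights \<Rightarrow> real) \<in> borel_measurable (weight_dist L wbar)"
  using integrable_weight_dist by (rule borel_measurable_integrable)

text \<open>Independence of the coordinates turns the expectation of a product into a product of
  two-point expectations.\<close>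

lemma integral_weight_dist_prod:
  fixes f :: "nat \<Rightarrow> bool \<Rightarrow> real"
  assumes "B \<subseteq> {1..L}" and "\<And>e. e \<in> B \<Longrightarrow> 0 \<le> wbar e \<and> wbar e \<le> 1"
  shows "(\<integral>v. (\<Prod>e\<in>B. f e (v e)) \<partial>weight_dist L wbar)
    = (\<Prod>e\<in>B. wbar e * f e True + (1 - wbar e) * f e False)"
proof -
  interpret product_sigma_finite "\<lambda>e. measure_pmf (bernoulli_pmf (wbar e))"
    by unfold_locales
  \<comment> \<open>Padding with the factor 1 extends the product to all coordinates; the padded
    factors integrate to 1.\<close>
  define g where "g e b = (if e \<in> B then f e b else 1)" for e b
  have "(\<integral>v. (\<Prod>e\<in>B. f e (v e)) \<partial>weight_dist L wbar)
      = (\<integral>v. (\<Prod>e\<in>{1..L}. g e (v e)) \<partial>weight_dist L wbar)"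
    using assms(1) by (intro Bochner_Integration.integral_cong prod.mono_neutral_cong_left refl) (auto simp: g_def)
  also have "\<dots> = (\<Prod>e\<in>{1..L}. \<integral>b. g e b \<partial>bernoulli_pmf (wbar e))"
    unfolding weight_dist_def
    by (intro product_integral_prod) (auto intro: integrable_measure_pmf_finite)
  also have "\<dots> = (\<Prod>e\<in>B. wbar e * f e True + (1 - wbar e) * f e False)"
    using assms by (intro prod.mono_neutral_cong_right) (auto simp: g_def mult.commute)
  finally show ?thesis .
qed

lemma reward_eq_prod:
  assumes "distinct A"
  shows "reward A w = 1 - (\<Prod>e\<in>set A. 1 - w e)"
  using assms by (simp add: reward_def prod.distinct_set_conv_list)

lemma reward_of_bool_bounds:
  assumes "distinct A"
  shows "0 \<le> reward A (\<lambda>e. of_bool (v e))" and "reward A (\<lambda>e. of_bool (v e)) \<le> 1"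
  using assms by (auto simp: reward_eq_prod intro!: prod_nonneg prod_le_1)

text \<open>The items are distinct, so the product in the reward has independent factors. Hence
  expected regret can be computed from the means.\<close>

lemma integral_reward:
  assumes "distinct A" "set A \<subseteq> {1..L}" and "\<And>e. e \<in> {1..L} \<Longrightarrow> 0 \<le> wbar e \<and> wbar e \<le> 1"
  shows "(\<integral>v. reward A (\<lambda>e. of_bool (v e)) \<partial>weight_dist L wbar) = reward A wbar"
proof -
  interpret prob_space "weight_dist L wbar" by (rule prob_space_weight_dist)
  show ?thesis
    using integral_weight_dist_prod[of "set A" L wbar "\<lambda>_ b. 1 - of_bool b"] assms
    by (simp add: reward_eq_prod integrable_weight_dist prob_space subset_iff)
qed

section \<open>Clicks and observations in terms of the weights\<close>

lemma click_ge_iff: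
  assumes "k < length A"
  shows "enat (Suc k) \<le> click A v \<longleftrightarrow> (\<forall>j<k. \<not> v (A ! j))"
proof
  assume *: "enat (Suc k) \<le> click A v"
  show "\<forall>j<k. \<not> v (A ! j)"
  proof (intro allI impI notI)
    fix j assume j: "j < k" "v (A ! j)"
    then have "click A v \<le> enat (Suc j)"
      using assms unfolding click_def by (intro Inf_lower imageI) auto
    with * have "enat (Suc k) \<le> enat (Suc j)"
      by (rule order_trans)
    with j show False by simp
  qed
next
  assume *: "\<forall>j<k. \<not> v (A ! j)"
  show "enat (Suc k) \<le> click A v"
    unfolding click_def
  proof (rule Inf_greatest)
    fix x assume "x \<in> enat ` {k \<in> {1..length A}. v (A ! (k - 1))}"
    then obtain i where i: "x = enat i" "i \<ge> 1" "v (A ! (i - 1))"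
      by auto
    with * have "\<not> i - 1 < k"
      by blast
    with i show "enat (Suc k) \<le> x"
      by simp
  qed
qed

lemma click_eq_iff:
  assumes "k < length A"
  shows "click A v = enat (Suc k) \<longleftrightarrow> (\<forall>j<k. \<not> v (A ! j)) \<and> v (A ! k)"
proof -
  have le: "click A v \<le> enat (Suc k)" if "v (A ! k)"
    using assms that unfolding click_def by (intro Inf_lower imageI) auto
  have mem: "v (A ! k)" if *: "click A v = enat (Suc k)"
  proof -
    let ?S = "enat ` {k \<in> {1..length A}. v (A ! (k - 1))}"
    \<comment> \<open>A finite click rules out the empty set, and a nonempty set in
      \<open>enat\<close> attains its infimum.\<close>
    have "?S \<noteq> {}"
      using * by (auto simp: click_def Inf_enat_def split: if_splits)
    then have "Inf ?S \<in> ?S"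
      using LeastI_ex[of "\<lambda>x. x \<in> ?S"] by (auto simp: Inf_enat_def simp del: image_iff)
    then show ?thesis
      using * by (auto simp: click_def)
  qed
  show ?thesis
    using click_ge_iff[OF assms, of v] le mem by (metis order.antisym order.refl)
qed

text \<open>Observation is decided by the preceding items alone, not by the item's own weight. This
  is the source of the independence used in \<open>integral_observed\<close>.\<close>

lemma observed_nth:
  assumes "distinct A" "k < length A"
  shows "observed (A ! k) (A, click A v) \<longleftrightarrow> (\<forall>j<k. \<not> v (A ! j))"
proof -
  have "observed (A ! k) (A, click A v) \<longleftrightarrow> enat (Suc k) \<le> click A v"
  proof
    assume "observed (A ! k) (A, click A v)"
    then obtain i where i: "i \<in> {1..length A}" "A ! k = A ! (i - 1)" "enat i \<le> click A v"
      by auto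
    then have "k = i - 1"
      using assms by (subst (asm) nth_eq_iff_index_eq) auto
    with i show "enat (Suc k) \<le> click A v" by simp
  next
    assume "enat (Suc k) \<le> click A v"
    then show "observed (A ! k) (A, click A v)"
      using assms by (auto intro!: bexI[of _ "Suc k"])
  qed
  then show ?thesis
    using click_ge_iff[OF assms(2)] by simp
qed

lemma observed_in_set: "observed e (A, C) \<Longrightarrow> e \<in> set A"
  by auto

lemma revealed_weight_nth:
  assumes "distinct A" "k < length A" "observed (A ! k) (A, click A v)"
  shows "revealed_weight (A ! k) (A, click A v) = of_bool (v (A ! k))"
proof -
  have "(\<exists>i\<in>{1..length A}. A ! k = A ! (i - 1) \<and> click A v = enat i) \<longleftrightarrow> click A v = enat (Suc k)"
  proof
    assume "\<exists>i\<in>{1..length A}. A ! k = A ! (i - 1) \<and> click A v = enat i"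
    then obtain i where i: "i \<in> {1..length A}" "A ! k = A ! (i - 1)" "click A v = enat i"
      by auto
    then have "k = i - 1"
      using assms by (subst (asm) nth_eq_iff_index_eq) auto
    with i show "click A v = enat (Suc k)" by simp
  next
    assume "click A v = enat (Suc k)"
    then show "\<exists>i\<in>{1..length A}. A ! k = A ! (i - 1) \<and> click A v = enat i"
      using assms by (auto intro!: bexI[of _ "Suc k"])
  qed
  then show ?thesis
    using assms observed_nth[OF assms(1,2)] click_eq_iff[OF assms(2)] by simp
qed

lemma revealed_weight_observed:
  assumes "distinct A" "observed e (A, click A v)"
  shows "revealed_weight e (A, click A v) = of_bool (v e)"
  using revealed_weight_nth[OF assms(1)] observed_in_set[OF assms(2)] assms(2)
  by (metis in_set_conv_nth)

text \<open>The event depends on the weights before position \<open>k\<close>, the factor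
  \<open>\<phi>\<close> on the weight at \<open>k\<close>, so the expectation factorizes. The
  constant 1 for \<open>\<phi>\<close> yields the probability of observation, an exponential
  increment the supermartingale step.\<close>

lemma integral_observed:
  assumes A: "distinct A" "set A \<subseteq> {1..L}" and k: "k < length A"
    and p: "\<And>e. e \<in> {1..L} \<Longrightarrow> 0 \<le> wbar e \<and> wbar e \<le> 1"
  shows "(\<integral>v. of_bool (observed (A ! k) (A, click A v)) * \<phi> (v (A ! k)) \<partial>weight_dist L wbar)
    = (\<Prod>j<k. 1 - wbar (A ! j)) * (wbar (A ! k) * \<phi> True + (1 - wbar (A ! k)) * \<phi> False)"
proof -
  \<comment> \<open>A single product over the positions up to \<open>k\<close> encodes both the
    event and the factor \<open>\<phi>\<close>.\<close>
  define f where "f e b = (if e = A ! k then \<phi> b else of_bool (\<not> b))" for e b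
  have ne: "A ! j \<noteq> A ! k" if "j < k" for j
    using that k A by (simp add: nth_eq_iff_index_eq)
  have inj: "inj_on ((!) A) {..k}"
    using A k by (intro inj_onI) (auto simp: nth_eq_iff_index_eq)
  have prod_split: "(\<Prod>e\<in>(!) A ` {..k}. h e) = h (A ! k) * (\<Prod>j<k. h (A ! j))" for h :: "nat \<Rightarrow> real"
  proof -
    have "{..k} = insert k {..<k}" by auto
    then show ?thesis by (subst prod.reindex[OF inj]) simp
  qed
  have "(\<integral>v. of_bool (observed (A ! k) (A, click A v)) * \<phi> (v (A ! k)) \<partial>weight_dist L wbar)
      = (\<integral>v. (\<Prod>e\<in>(!) A ` {..k}. f e (v e)) \<partial>weight_dist L wbar)"
  proof (intro Bochner_Integration.integral_cong refl)
    fix v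
    have "(\<Prod>j<k. f (A ! j) (v (A ! j))) = (\<Prod>j<k. of_bool (\<not> v (A ! j)))"
      using ne by (intro prod.cong) (auto simp: f_def)
    also have "\<dots> = of_bool (\<forall>j<k. \<not> v (A ! j))"
      by (induction k) (auto simp: less_Suc_eq)
    finally show "of_bool (observed (A ! k) (A, click A v)) * \<phi> (v (A ! k)) = (\<Prod>e\<in>(!) A ` {..k}. f e (v e))"
      using observed_nth[OF A(1) k] by (simp add: prod_split f_def)
  qed
  also have "\<dots> = (\<Prod>e\<in>(!) A ` {..k}. wbar e * f e True + (1 - wbar e) * f e False)"
    using A k p nth_mem[of _ A] by (intro integral_weight_dist_prod) (auto simp: subset_iff)
  also have "\<dots> = (\<Prod>j<k. 1 - wbar (A ! j)) * (wbar (A ! k) * \<phi> True + (1 - wbar (A ! k)) * \<phi> False)"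
    unfolding prod_split using ne by (simp add: f_def)
  finally show ?thesis .
qed

text \<open>Exchange the factors one at a time and drop the trailing factors \<open>y\<close>, which
  are at most 1. If \<open>x\<close> lists the failure probabilities of a recommended list, the
  partial products are its observation probabilities.\<close>

lemma prod_diff_le_telescope:
  fixes x y :: "nat \<Rightarrow> real"
  assumes "\<And>k. k < m \<Longrightarrow> 0 \<le> y k" "\<And>k. k < m \<Longrightarrow> y k \<le> x k" "\<And>k. k < m \<Longrightarrow> x k \<le> 1"
  shows "(\<Prod>k<m. x k) - (\<Prod>k<m. y k) \<le> (\<Sum>k<m. (\<Prod>j<k. x j) * (x k - y k))"
  using assms
proof (induction m)
  case (Suc m)
  have le: "(\<Prod>k<m. y k) \<le> (\<Prod>k<m. x k)"
    using Suc.prems by (intro prod_mono) auto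
  have "(\<Prod>k<Suc m. x k) - (\<Prod>k<Suc m. y k)
      = (\<Prod>k<m. x k) * (x m - y m) + ((\<Prod>k<m. x k) - (\<Prod>k<m. y k)) * y m"
    by (simp add: algebra_simps)
  also have "\<dots> \<le> (\<Prod>k<m. x k) * (x m - y m) + ((\<Prod>k<m. x k) - (\<Prod>k<m. y k)) * 1"
    using le Suc.prems[of m] Suc.prems(2)[of m] Suc.prems(3)[of m]
    by (intro add_left_mono mult_left_mono) auto
  also have "\<dots> \<le> (\<Sum>k<Suc m. (\<Prod>j<k. x j) * (x k - y k))"
    using Suc by simp
  finally show ?case .
qed simp

text \<open>The list contains as many suboptimal items as it misses optimal ones, so each of the
  former can be paired with an optimal item that it displaces.\<close>

lemma perms_matching:
  assumes "A \<in> perms L K" "K \<le> L"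
  obtains \<sigma> where "bij_betw \<sigma> (set A) {1..K}" and "\<And>e. e \<in> set A \<Longrightarrow> e \<le> K \<Longrightarrow> \<sigma> e = e"
    and "\<And>e. e \<in> set A \<Longrightarrow> e > K \<Longrightarrow> \<sigma> e \<in> {1..K} - set A"
proof -
  have A: "distinct A" "set A \<subseteq> {1..L}" "card (set A) = K"
    using assms by (auto simp: perms_def distinct_card)
  have "card (set A - {1..K}) = card ({1..K} - set A)"
    using A by (simp add: card_Diff_subset_Int Int_commute)
  then obtain g where g: "bij_betw g (set A - {1..K}) ({1..K} - set A)"
    by (metis List.finite_set finite_Diff finite_atLeastAtMost finite_same_card_bij)
  define \<sigma> where "\<sigma> e = (if e \<in> {1..K} then e else g e)" for e
  have "bij_betw \<sigma> ((set A \<inter> {1..K}) \<union> (set A - {1..K})) ((set A \<inter> {1..K}) \<union> ({1..K} - set A))"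
  proof (rule bij_betw_combine)
    show "bij_betw \<sigma> (set A \<inter> {1..K}) (set A \<inter> {1..K})"
      by (auto simp: bij_betw_def inj_on_def \<sigma>_def)
    show "bij_betw \<sigma> (set A - {1..K}) ({1..K} - set A)"
      using g by (rule bij_betw_cong[THEN iffD1, rotated]) (auto simp: \<sigma>_def)
  qed auto
  moreover have "(set A \<inter> {1..K}) \<union> (set A - {1..K}) = set A"
    and "(set A \<inter> {1..K}) \<union> ({1..K} - set A) = {1..K}"
    by auto
  ultimately have bij: "bij_betw \<sigma> (set A) {1..K}"
    by simp
  show thesis
  proof (rule that[OF bij])
    fix e assume "e \<in> set A" "e \<le> K"
    then show "\<sigma> e = e" using A(2) by (auto simp: \<sigma>_def)
  next
    fix e assume "e \<in> set A" "e > K"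
    then show "\<sigma> e \<in> {1..K} - set A"
      using bij_betw_apply[OF g, of e] by (auto simp: \<sigma>_def)
  qed
qed

subsection \<open>Histories\<close>

definition hist :: "policy \<Rightarrow> (nat \<Rightarrow> weights) \<Rightarrow> nat \<Rightarrow> history" where
  "hist \<pi> v t = (v 0, observations \<pi> v t)"

text \<open>One step with the fresh weight vector as a separate argument, so that it can be
  integrated out while the history is fixed.\<close>

definition extend :: "policy \<Rightarrow> history \<Rightarrow> weights \<Rightarrow> history" where
  "extend \<pi> h v = (fst h, snd h @ [(\<pi> h, click (\<pi> h) v)])"

definition obs_sum :: "history \<Rightarrow> nat \<Rightarrow> real" where
  "obs_sum h e = sum_list (observed_weights h e)"

lemma hist_Suc: "hist \<pi> v (Suc t) = extend \<pi> (hist \<pi> v t) (v (Suc t))"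
  by (simp add: hist_def extend_def Let_def)

lemma hist_cong: "(\<And>s. s \<le> t \<Longrightarrow> v s = v' s) \<Longrightarrow> hist \<pi> v t = hist \<pi> v' t"
  by (induction t) (auto simp: hist_Suc, simp add: hist_def)

lemma length_hist: "length (snd (hist \<pi> v t)) = t"
  by (induction t) (simp_all add: hist_Suc extend_def, simp add: hist_def)

lemma obs_count_hist_0: "obs_count (hist \<pi> v 0) e = 1"
  by (simp add: hist_def obs_count_def)

lemma obs_sum_hist_0: "obs_sum (hist \<pi> v 0) e = of_bool (v 0 e)"
  by (simp add: hist_def obs_sum_def observed_weights_def)

lemma obs_count_extend:
  "obs_count (extend \<pi> h v) e = obs_count h e + of_bool (observed e (\<pi> h, click (\<pi> h) v))"
  by (simp add: extend_def obs_count_def)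

lemma obs_sum_extend:
  assumes "distinct (\<pi> h)"
  shows "obs_sum (extend \<pi> h v) e
    = obs_sum h e + of_bool (observed e (\<pi> h, click (\<pi> h) v)) * of_bool (v e)"
  using revealed_weight_observed[OF assms, of e v]
  by (simp add: extend_def obs_sum_def observed_weights_def del: observed.simps revealed_weight.simps)

lemma obs_count_bounds: "1 \<le> obs_count h e" "obs_count h e \<le> length (snd h) + 1"
  by (auto simp: obs_count_def)

lemma mean_weight_obs_count: "mean_weight h (obs_count h e) e = obs_sum h e / real (obs_count h e)"
  by (simp add: mean_weight_def obs_sum_def observed_weights_def obs_count_def)

text \<open>Uniqueness of the optimal set enters here as \<open>gap_pos\<close>; the final theorem
  derives it.\<close>

locale cascade_bandit = prob_space M for M :: "'a measure" +
  fixes w :: "nat \<Rightarrow> 'a \<Rightarrow> weights" and wbar :: "nat \<Rightarrow> real" and L K :: nat and \<pi> :: policy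
  assumes K_pos: "1 \<le> K" and K_le_L: "K \<le> L"
    and wbar_bounds: "\<And>e. e \<in> {1..L} \<Longrightarrow> 0 \<le> wbar e \<and> wbar e \<le> 1"
    and indep: "indep_vars (\<lambda>_. weight_dist L wbar) w UNIV"
    and distr_w: "\<And>t. distr M (weight_dist L wbar) (w t) = weight_dist L wbar"
    and wbar_mono: "\<And>i j. 1 \<le> i \<Longrightarrow> i \<le> j \<Longrightarrow> j \<le> L \<Longrightarrow> wbar j \<le> wbar i"
    and gap_pos: "\<And>e. e \<in> {K+1..L} \<Longrightarrow> gap wbar e K > 0"
    and ucb_policy: "cascade_ucb1 L K \<pi>"
begin

abbreviation W :: "weights measure" where "W \<equiv> weight_dist L wbar"

abbreviation H :: "nat \<Rightarrow> 'a \<Rightarrow> history" where "H t \<omega> \<equiv> hist \<pi> (\<lambda>s. w s \<omega>) t"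

sublocale W: prob_space W by (rule prob_space_weight_dist)

lemma policy_perms: "\<pi> h \<in> perms L K"
  using ucb_policy unfolding cascade_ucb1_def by blast

lemma policy_distinct: "distinct (\<pi> h)" and policy_subset: "set (\<pi> h) \<subseteq> {1..L}"
  and policy_length: "length (\<pi> h) = K"
  using policy_perms[of h] by (auto simp: perms_def)

lemma measurable_w: "w t \<in> measurable M W"
  using indep by (auto simp: indep_vars_def)

text \<open>The weight paths up to a fixed time form a finite space, so every functional of them is
  integrable, whatever the policy.\<close>

lemma integrable_path:
  fixes g :: "(nat \<Rightarrow> weights) \<Rightarrow> real"
  shows "integrable M (\<lambda>\<omega>. g (restrict (\<lambda>s. w s \<omega>) {..t}))"
proof (rule integrable_discrete_rv[where N = "PiM {..t} (\<lambda>_. W)" and X = "\<lambda>\<omega>. restrict (\<lambda>s. w s \<omega>) {..t}"])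
  show "(\<lambda>\<omega>. restrict (\<lambda>s. w s \<omega>) {..t}) \<in> measurable M (PiM {..t} (\<lambda>_. W))"
    by (intro measurable_restrict measurable_w)
  show "finite (space (PiM {..t} (\<lambda>_. W)))"
    by (simp add: space_PiM finite_PiE finite_space_weight_dist)
  show "sets (PiM {..t} (\<lambda>_. W)) = Pow (space (PiM {..t} (\<lambda>_. W)))"
    by (rule sets_PiM_finite_discrete) (simp_all add: finite_space_weight_dist sets_weight_dist)
qed

lemma H_restrict: "H t \<omega> = hist \<pi> (restrict (\<lambda>s. w s \<omega>) {..t}) t"
  by (rule hist_cong) simp

lemma integrable_H: "integrable M (\<lambda>\<omega>. (g (H t \<omega>) :: real))"
  unfolding H_restrict by (rule integrable_path)

lemma integrable_H_step: "integrable M (\<lambda>\<omega>. (g (H t \<omega>) (w (Suc t) \<omega>) :: real))"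
proof -
  have "H t \<omega> = hist \<pi> (restrict (\<lambda>s. w s \<omega>) {..Suc t}) t" for \<omega>
    by (rule hist_cong) simp
  then show ?thesis
    using integrable_path[of "\<lambda>v. g (hist \<pi> v t) (v (Suc t))" "Suc t"] by simp
qed

text \<open>Plays the part of conditioning on the past: the history is a function of
  \<open>w 0, ..., w t\<close>, which are independent of \<open>w (Suc t)\<close>, so Fubini
  integrates the fresh weights with the history fixed.\<close>

lemma expectation_H_step:
  fixes g :: "history \<Rightarrow> weights \<Rightarrow> real"
  shows "expectation (\<lambda>\<omega>. g (H t \<omega>) (w (Suc t) \<omega>)) = expectation (\<lambda>\<omega>. \<integral>v. g (H t \<omega>) v \<partial>W)"
proof -
  let ?P = "PiM {..t} (\<lambda>_. W)" and ?Q = "PiM {Suc t} (\<lambda>_. W)"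
  let ?X = "\<lambda>\<omega>. restrict (\<lambda>s. w s \<omega>) {..t}" and ?Y = "\<lambda>\<omega>. restrict (\<lambda>s. w s \<omega>) {Suc t}"
  let ?f = "\<lambda>(x, y). g (hist \<pi> x t) (y (Suc t))"
  have sets: "sets ?P = Pow (space ?P)" "sets ?Q = Pow (space ?Q)"
    by (rule sets_PiM_finite_discrete; simp add: finite_space_weight_dist sets_weight_dist)+
  have fin: "finite (space ?P)" "finite (space ?Q)"
    by (simp_all add: space_PiM finite_PiE finite_space_weight_dist)
  have sets_PQ: "sets (?P \<Otimes>\<^sub>M ?Q) = Pow (space ?P \<times> space ?Q)"
    using fin sets by (intro sets_pair_countable) (auto intro: countable_finite)
  have X: "?X \<in> measurable M ?P" and Y: "?Y \<in> measurable M ?Q"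
    by (intro measurable_restrict measurable_w)+
  have XY: "(\<lambda>\<omega>. (?X \<omega>, ?Y \<omega>)) \<in> measurable M (?P \<Otimes>\<^sub>M ?Q)"
    by (intro measurable_Pair X Y)
  \<comment> \<open>The index sets \<open>{..t}\<close> and \<open>{Suc t}\<close> are disjoint, so
    the two blocks are independent and their joint law is a product.\<close>
  have "indep_var ?P ?X ?Q ?Y"
    using indep by (rule indep_var_restrict) auto
  then have joint: "distr M ?P ?X \<Otimes>\<^sub>M distr M ?Q ?Y = distr M (?P \<Otimes>\<^sub>M ?Q) (\<lambda>\<omega>. (?X \<omega>, ?Y \<omega>))"
    by (simp add: indep_var_distribution_eq)
  interpret X: prob_space "distr M ?P ?X" by (rule prob_space_distr) fact
  interpret Y: prob_space "distr M ?Q ?Y" by (rule prob_space_distr) fact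
  interpret XY: pair_prob_space "distr M ?P ?X" "distr M ?Q ?Y" ..
  have f: "?f \<in> borel_measurable (?P \<Otimes>\<^sub>M ?Q)"
    by (auto simp: measurable_def sets_PQ space_pair_measure)
  have int: "integrable (distr M ?P ?X \<Otimes>\<^sub>M distr M ?Q ?Y) ?f"
    unfolding joint
    by (subst integrable_distr_eq[OF XY f])
      (rule integrable_discrete_rv[OF XY], simp_all add: space_pair_measure fin sets_PQ)
  have inner: "(\<integral>y. g h (y (Suc t)) \<partial>distr M ?Q ?Y) = (\<integral>v. g h v \<partial>W)" for h
  proof -
    have "(\<integral>y. g h (y (Suc t)) \<partial>distr M ?Q ?Y) = expectation (\<lambda>\<omega>. g h (w (Suc t) \<omega>))"
      by (subst integral_distr[OF Y]) (auto simp: measurable_def sets)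
    also have "\<dots> = (\<integral>v. g h v \<partial>distr M W (w (Suc t)))"
      by (rule integral_distr[symmetric, OF measurable_w borel_measurable_weight_dist])
    finally show ?thesis
      by (simp add: distr_w)
  qed
  have "expectation (\<lambda>\<omega>. g (H t \<omega>) (w (Suc t) \<omega>)) = expectation (\<lambda>\<omega>. ?f (?X \<omega>, ?Y \<omega>))"
    unfolding H_restrict by simp
  also have "\<dots> = integral\<^sup>L (distr M ?P ?X \<Otimes>\<^sub>M distr M ?Q ?Y) ?f"
    unfolding joint by (rule integral_distr[symmetric, OF XY f])
  also have "\<dots> = (\<integral>x. \<integral>y. ?f (x, y) \<partial>distr M ?Q ?Y \<partial>distr M ?P ?X)"
    using int by (rule XY.integral_fst'[symmetric])
  also have "\<dots> = (\<integral>x. \<integral>v. g (hist \<pi> x t) v \<partial>W \<partial>distr M ?P ?X)"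
    by (simp add: inner)
  also have "\<dots> = expectation (\<lambda>\<omega>. \<integral>v. g (hist \<pi> (?X \<omega>) t) v \<partial>W)"
    by (subst integral_distr[OF X]) (auto simp: measurable_def sets)
  finally show ?thesis
    unfolding H_restrict .
qed

subsection \<open>Confidence bounds\<close>

text \<open>The exponential process of Hoeffding's inequality, run on the clock of observations of
  \<open>e\<close> rather than on time; \<open>l\<^sup>2 / 8\<close> is the compensator per
  observation.\<close>

definition exp_supermartingale :: "real \<Rightarrow> nat \<Rightarrow> history \<Rightarrow> real" where
  "exp_supermartingale l e h =
     exp (l * (obs_sum h e - real (obs_count h e) * wbar e) - l\<^sup>2 / 8 * real (obs_count h e))"

lemma exp_increment_le:
  assumes "e \<in> {1..L}"
  shows "wbar e * exp (l * (1 - wbar e) - l\<^sup>2 / 8) + (1 - wbar e) * exp (l * (0 - wbar e) - l\<^sup>2 / 8) \<le> 1"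
proof -
  have "(wbar e * exp (l * (1 - wbar e)) + (1 - wbar e) * exp (l * (0 - wbar e))) / exp (l\<^sup>2 / 8) \<le> 1"
    using hoeffding_bernoulli[of "wbar e" l] wbar_bounds[OF assms] by simp
  then show ?thesis
    by (simp add: exp_diff add_divide_distrib)
qed

text \<open>An unobserved step changes nothing; an observed one multiplies by an exponential
  increment of mean at most 1, independent of the event of observation.\<close>

lemma exp_supermartingale_step:
  assumes e: "e \<in> {1..L}"
  shows "(\<integral>v. exp_supermartingale l e (extend \<pi> h v) \<partial>W) \<le> exp_supermartingale l e h"
proof -
  let ?obs = "\<lambda>v. observed e (\<pi> h, click (\<pi> h) v)"
  let ?y = "\<lambda>b. l * (of_bool b - wbar e) - l\<^sup>2 / 8"
  have eq: "exp_supermartingale l e (extend \<pi> h v)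
      = exp_supermartingale l e h * (1 + of_bool (?obs v) * (exp (?y (v e)) - 1))" for v
    by (cases "?obs v")
      (simp_all add: exp_supermartingale_def obs_count_extend obs_sum_extend[OF policy_distinct]
        algebra_simps flip: exp_add del: observed.simps)
  have le: "(\<integral>v. of_bool (?obs v) * (exp (?y (v e)) - 1) \<partial>W) \<le> 0"
  proof (cases "e \<in> set (\<pi> h)")
    case False
    then have "\<not> ?obs v" for v
      using observed_in_set by blast
    then show ?thesis by (simp del: observed.simps)
  next
    case True
    then obtain k where k: "k < length (\<pi> h)" "\<pi> h ! k = e"
      by (auto simp: in_set_conv_nth)
    have "(\<integral>v. of_bool (?obs v) * (exp (?y (v e)) - 1) \<partial>W)
      = (\<Prod>j<k. 1 - wbar (\<pi> h ! j)) *
        (wbar e * (exp (?y True) - 1) + (1 - wbar e) * (exp (?y False) - 1))"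
      using integral_observed[where \<phi> = "\<lambda>b. exp (?y b) - 1", OF policy_distinct policy_subset k(1) wbar_bounds]
      by (simp add: k(2) del: observed.simps)
    also have "\<dots> \<le> 0"
    proof (rule mult_nonneg_nonpos)
      show "0 \<le> (\<Prod>j<k. 1 - wbar (\<pi> h ! j))"
        using wbar_bounds policy_subset[of h] k(1) by (intro prod_nonneg) (auto simp: subset_iff)
      show "wbar e * (exp (?y True) - 1) + (1 - wbar e) * (exp (?y False) - 1) \<le> 0"
        using exp_increment_le[OF e, of l] by (simp add: algebra_simps)
    qed
    finally show ?thesis .
  qed
  have "(\<integral>v. exp_supermartingale l e (extend \<pi> h v) \<partial>W)
      = exp_supermartingale l e h * (1 + (\<integral>v. of_bool (?obs v) * (exp (?y (v e)) - 1) \<partial>W))"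
    unfolding eq by (simp add: integrable_weight_dist W.prob_space del: observed.simps)
  also have "\<dots> \<le> exp_supermartingale l e h * 1"
    using le by (intro mult_left_mono) (auto simp: exp_supermartingale_def)
  finally show ?thesis by simp
qed

lemma expectation_exp_supermartingale:
  assumes e: "e \<in> {1..L}"
  shows "expectation (\<lambda>\<omega>. exp_supermartingale l e (H t \<omega>)) \<le> 1"
proof (induction t)
  case 0
  let ?y = "\<lambda>b. l * (of_bool b - wbar e) - l\<^sup>2 / 8"
  \<comment> \<open>The initial weight vector already counts as one observation, so the base case is
    itself one increment.\<close>
  have "expectation (\<lambda>\<omega>. exp_supermartingale l e (H 0 \<omega>)) = expectation (\<lambda>\<omega>. exp (?y (w 0 \<omega> e)))"
    by (simp add: exp_supermartingale_def obs_sum_hist_0 obs_count_hist_0)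
  also have "\<dots> = (\<integral>v. exp (?y (v e)) \<partial>distr M W (w 0))"
    by (rule integral_distr[symmetric, OF measurable_w borel_measurable_weight_dist])
  also have "\<dots> = wbar e * exp (?y True) + (1 - wbar e) * exp (?y False)"
    using integral_weight_dist_prod[of "{e}" L wbar "\<lambda>_ b. exp (?y b)"] e wbar_bounds[OF e]
    by (simp add: distr_w)
  also have "\<dots> \<le> 1"
    using exp_increment_le[OF e] by simp
  finally show ?case .
next
  case (Suc t)
  have "expectation (\<lambda>\<omega>. exp_supermartingale l e (H (Suc t) \<omega>))
      = expectation (\<lambda>\<omega>. \<integral>v. exp_supermartingale l e (extend \<pi> (H t \<omega>) v) \<partial>W)"
    unfolding hist_Suc
    by (rule expectation_H_step[where g = "\<lambda>h v. exp_supermartingale l e (extend \<pi> h v)"])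
  also have "\<dots> \<le> expectation (\<lambda>\<omega>. exp_supermartingale l e (H t \<omega>))"
    by (intro integral_mono integrable_H exp_supermartingale_step[OF e])
  also have "\<dots> \<le> 1" by (rule Suc.IH)
  finally show ?case .
qed

text \<open>
  Only deviations that can cause a suboptimal choice count: optimal items are underestimated,
  suboptimal items are overestimated. Two-sided deviations would cost a factor of 2.
\<close>

definition misled :: "history \<Rightarrow> nat \<Rightarrow> bool" where
  "misled h e \<longleftrightarrow>
     (let m = obs_sum h e / real (obs_count h e); c = conf_radius (length (snd h)) (obs_count h e)
      in if e \<le> K then m + c < wbar e else wbar e + c < m)"

text \<open>Chernoff's argument made pointwise. The best \<open>l\<close> depends on the random
  number of observations, so the bound sums over all values that number can take, from 1 to
  \<open>t + 1\<close>.\<close>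

lemma misled_le:
  assumes t: "length (snd h) = t" "t \<ge> 1"
  shows "of_bool (misled h e) \<le> (\<Sum>s=1..t+1.
    exp_supermartingale ((if e \<le> K then -1 else 1) * 4 * conf_radius t s) e h) / real t ^ 3"
proof (cases "misled h e")
  case True
  \<comment> \<open>The sign \<open>z\<close> makes both kinds of deviation upward ones. The size
    \<open>4 * c\<close> maximizes \<open>l * c * s - l\<^sup>2 / 8 * s\<close>, with value
    \<open>2 * c\<^sup>2 * s = 3 * ln t\<close>.\<close>
  define s c z l where "s = real (obs_count h e)" and "c = conf_radius t (obs_count h e)"
    and "z = (if e \<le> K then -1 else 1 :: real)" and "l = z * 4 * c"
  have s: "s \<ge> 1" using obs_count_bounds[of h e] by (simp add: s_def)
  have c: "c \<ge> 0" and c2: "c\<^sup>2 * s = 1.5 * ln t"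
    using t s by (auto simp: c_def conf_radius_def s_def)
  have dev: "z * (obs_sum h e - s * wbar e) > c * s"
    using True s t(1) by (auto simp: misled_def Let_def s_def c_def z_def field_simps split: if_splits)
  have "3 * ln (real t) = 4 * c * (c * s) - 2 * c\<^sup>2 * s"
    using c2 by (simp add: power2_eq_square algebra_simps)
  also have "\<dots> \<le> 4 * c * (z * (obs_sum h e - s * wbar e)) - 2 * c\<^sup>2 * s"
    using dev c by (intro diff_right_mono mult_left_mono) auto
  also have "\<dots> = l * (obs_sum h e - s * wbar e) - l\<^sup>2 / 8 * s"
    by (auto simp: l_def z_def power2_eq_square algebra_simps)
  finally have "exp (3 * ln (real t)) \<le> exp_supermartingale l e h"
    by (simp add: exp_supermartingale_def s_def)
  moreover have "exp (3 * ln (real t)) = real t ^ 3"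
    using t(2) exp_of_nat_mult[of 3 "ln (real t)"] by simp
  ultimately have "real t ^ 3 \<le> exp_supermartingale l e h" by simp
  \<comment> \<open>The actual number of observations is one of the indices, and the other summands
    are nonnegative.\<close>
  also have "\<dots> \<le> (\<Sum>s=1..t+1. exp_supermartingale (z * 4 * conf_radius t s) e h)"
    unfolding l_def c_def using obs_count_bounds[of h e] t(1)
    by (intro member_le_sum[where f = "\<lambda>s. exp_supermartingale (z * 4 * conf_radius t s) e h"])
      (auto simp: exp_supermartingale_def)
  finally show ?thesis
    using True t(2) by (simp add: z_def field_simps)
next
  case False
  have "0 \<le> (\<Sum>s=1..t+1. exp_supermartingale (l s) e h) / real t ^ 3" for l
    by (intro divide_nonneg_nonneg sum_nonneg) (simp_all add: exp_supermartingale_def)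
  with False show ?thesis
    by (simp only: of_bool_eq)
qed

lemma expectation_misled_le:
  assumes "e \<in> {1..L}" "t \<ge> 1"
  shows "expectation (\<lambda>\<omega>. of_bool (misled (H t \<omega>) e)) \<le> real (t + 1) / real t ^ 3"
proof -
  let ?l = "\<lambda>s. (if e \<le> K then -1 else 1) * 4 * conf_radius t s"
  have "expectation (\<lambda>\<omega>. of_bool (misled (H t \<omega>) e))
      \<le> expectation (\<lambda>\<omega>. (\<Sum>s=1..t+1. exp_supermartingale (?l s) e (H t \<omega>)) / real t ^ 3)"
    using assms(2)
    by (intro integral_mono integrable_H[where g = "\<lambda>h. of_bool (misled h e)"] misled_le length_hist
        integrable_H[where g = "\<lambda>h. (\<Sum>s=1..t+1. exp_supermartingale (?l s) e h) / real t ^ 3"])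
  also have "\<dots> = (\<Sum>s=1..t+1. expectation (\<lambda>\<omega>. exp_supermartingale (?l s) e (H t \<omega>))) / real t ^ 3"
    by (subst Bochner_Integration.integral_divide_zero, subst Bochner_Integration.integral_sum)
      (auto intro: integrable_H)
  also have "\<dots> \<le> (\<Sum>s=1..t+1. 1) / real t ^ 3"
    by (intro divide_right_mono sum_mono expectation_exp_supermartingale assms(1)) auto
  finally show ?thesis by simp
qed

subsection \<open>Regret of a single step\<close>

text \<open>Twice the confidence radius at time \<open>n\<close>, since \<open>4 * 1.5 = 6\<close>,
  cut off at the number of observations beyond which \<open>e\<close> is not recommended after a
  reliable history up to step \<open>n\<close>.\<close>

definition exploration_cost :: "nat \<Rightarrow> nat \<Rightarrow> nat \<Rightarrow> real" where
  "exploration_cost n e s =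
     (if real s \<le> 6 * ln (real n) / (gap wbar e K)\<^sup>2 then sqrt (6 * ln (real n) / real s) else 0)"

lemma exploration_cost_nonneg: "n \<ge> 1 \<Longrightarrow> exploration_cost n e s \<ge> 0"
  by (simp add: exploration_cost_def)

text \<open>Optimism: \<open>wbar f \<le> ucb h f \<le> ucb h e\<close>, and \<open>ucb h e\<close>
  exceeds \<open>wbar e\<close> by at most two radii. The cut-off is respected because the gap to
  \<open>K\<close> is no larger than the gap to \<open>f\<close>.\<close>

lemma gap_le_exploration_cost:
  assumes good: "\<forall>e\<in>{1..L}. \<not> misled h e" and t: "1 \<le> length (snd h)" "length (snd h) \<le> n"
    and e: "e \<in> set (\<pi> h)" "e > K" and f: "f \<in> {1..K} - set (\<pi> h)"
  shows "wbar f - wbar e \<le> exploration_cost n e (obs_count h e)"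
proof -
  define s D C where "s = real (obs_count h e)" and "D = wbar f - wbar e" and "C = 6 * ln (real n)"
  have s: "s \<ge> 1" using obs_count_bounds[of h e] by (simp add: s_def)
  have eL: "e \<in> {1..L}" "e \<in> {K+1..L}" and fL: "f \<in> {1..L}" "f \<le> K"
    using e f policy_subset[of h] K_le_L by auto
  have "ucb h f \<le> ucb h e"
    using ucb_policy e(1) f fL unfolding cascade_ucb1_def by blast
  moreover have "wbar f \<le> ucb h f" and "ucb h e \<le> wbar e + 2 * conf_radius (length (snd h)) (obs_count h e)"
    using bspec[OF good eL(1)] bspec[OF good fL(1)] fL(2) e(2)
    by (simp_all add: misled_def ucb_def mean_weight_obs_count Let_def)
  ultimately have "D \<le> 2 * conf_radius (length (snd h)) (obs_count h e)"
    by (simp add: D_def)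
  also have "\<dots> = sqrt (4 * (1.5 * ln (real (length (snd h))) / s))"
    using t by (subst real_sqrt_mult) (auto simp: conf_radius_def s_def)
  also have "\<dots> \<le> sqrt (C / s)"
    using t s by (auto simp: C_def intro!: divide_right_mono ln_mono)
  finally have D: "D \<le> sqrt (C / s)" .
  have g: "0 < gap wbar e K" "gap wbar e K \<le> D"
    using gap_pos[OF eL(2)] wbar_mono[of f K] f K_le_L by (auto simp: D_def gap_def)
  have "C / s \<ge> 0"
    using s t by (simp add: C_def)
  then have "(gap wbar e K)\<^sup>2 \<le> C / s"
    using g D by (metis order_trans less_imp_le power_mono real_sqrt_pow2)
  then have "s \<le> C / (gap wbar e K)\<^sup>2"
    using g s by (simp add: field_simps)
  with D show ?thesis
    by (simp add: exploration_cost_def s_def C_def D_def)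
qed

text \<open>Compare the two products along the list: the probability that no earlier item attracts
  is that of observing the next position, and it weights the gap there.\<close>

lemma reward_gap_le:
  assumes "distinct Astar" "set Astar = {1..K}"
    and \<sigma>: "bij_betw \<sigma> (set (\<pi> h)) {1..K}" "\<And>e. e \<in> set (\<pi> h) \<Longrightarrow> wbar e \<le> wbar (\<sigma> e)"
  shows "reward Astar wbar - reward (\<pi> h) wbar
    \<le> (\<Sum>e\<in>set (\<pi> h). (\<integral>v. of_bool (observed e (\<pi> h, click (\<pi> h) v)) \<partial>W) * (wbar (\<sigma> e) - wbar e))"
proof -
  let ?A = "\<pi> h"
  have nth_bij: "bij_betw ((!) ?A) {..<K} (set ?A)"
    using bij_betw_nth[OF policy_distinct refl refl] policy_length by simp
  have sub: "?A ! k \<in> set ?A" "?A ! k \<in> {1..L}" "\<sigma> (?A ! k) \<in> {1..L}" if "k < K" for k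
  proof -
    show *: "?A ! k \<in> set ?A"
      using that policy_length[of h] by auto
    then show "?A ! k \<in> {1..L}"
      using policy_subset by blast
    show "\<sigma> (?A ! k) \<in> {1..L}"
      using bij_betw_apply[OF \<sigma>(1) *] K_le_L by auto
  qed
  have prod_nth: "(\<Prod>k<K. x (?A ! k)) = (\<Prod>e\<in>set ?A. x e)" for x :: "nat \<Rightarrow> real"
    by (rule prod.reindex_bij_betw[OF nth_bij])
  have "reward Astar wbar - reward ?A wbar = (\<Prod>e\<in>set ?A. 1 - wbar e) - (\<Prod>e\<in>{1..K}. 1 - wbar e)"
    using assms(1,2) policy_distinct by (simp add: reward_eq_prod)
  also have "(\<Prod>e\<in>{1..K}. 1 - wbar e) = (\<Prod>e\<in>set ?A. 1 - wbar (\<sigma> e))"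
    by (rule prod.reindex_bij_betw[OF \<sigma>(1), symmetric])
  also have "(\<Prod>e\<in>set ?A. 1 - wbar e) - (\<Prod>e\<in>set ?A. 1 - wbar (\<sigma> e))
      = (\<Prod>k<K. 1 - wbar (?A ! k)) - (\<Prod>k<K. 1 - wbar (\<sigma> (?A ! k)))"
    using prod_nth[of "\<lambda>e. 1 - wbar e"] prod_nth[of "\<lambda>e. 1 - wbar (\<sigma> e)"] by simp
  also have "\<dots> \<le> (\<Sum>k<K. (\<Prod>j<k. 1 - wbar (?A ! j)) * ((1 - wbar (?A ! k)) - (1 - wbar (\<sigma> (?A ! k)))))"
    using sub wbar_bounds \<sigma>(2) by (intro prod_diff_le_telescope) auto
  also have "\<dots> = (\<Sum>k<K. (\<integral>v. of_bool (observed (?A ! k) (?A, click ?A v)) \<partial>W)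
      * (wbar (\<sigma> (?A ! k)) - wbar (?A ! k)))"
  proof (intro sum.cong refl)
    fix k assume "k \<in> {..<K}"
    then have "(\<integral>v. of_bool (observed (?A ! k) (?A, click ?A v)) \<partial>W) = (\<Prod>j<k. 1 - wbar (?A ! j))"
      using integral_observed[where k = k and \<phi> = "\<lambda>_. 1", OF policy_distinct policy_subset _ wbar_bounds]
      by (simp add: policy_length del: observed.simps)
    then show "(\<Prod>j<k. 1 - wbar (?A ! j)) * ((1 - wbar (?A ! k)) - (1 - wbar (\<sigma> (?A ! k))))
        = (\<integral>v. of_bool (observed (?A ! k) (?A, click ?A v)) \<partial>W) * (wbar (\<sigma> (?A ! k)) - wbar (?A ! k))"
      by simp
  qed
  also have "\<dots> = (\<Sum>e\<in>set ?A. (\<integral>v. of_bool (observed e (?A, click ?A v)) \<partial>W) * (wbar (\<sigma> e) - wbar e))"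
    by (rule sum.reindex_bij_betw[OF nth_bij])
  finally show ?thesis .
qed

text \<open>With fewer than two recorded steps the confidence radius is 0, by convention or since
  \<open>ln 1 = 0\<close>, and the deviation bounds give nothing.\<close>

definition unreliable :: "history \<Rightarrow> bool" where
  "unreliable h \<longleftrightarrow> length (snd h) < 2 \<or> (\<exists>e\<in>{1..L}. misled h e)"

text \<open>Charged only on actual observation: in expectation this reproduces the probability
  weights, and along a run it telescopes.\<close>

definition step_cost :: "nat \<Rightarrow> history \<Rightarrow> weights \<Rightarrow> real" where
  "step_cost n h v =
     (\<Sum>e=K+1..L. of_bool (observed e (\<pi> h, click (\<pi> h) v)) * exploration_cost n e (obs_count h e))"

text \<open>After an unreliable history the regret is at most 1 because rewards lie in
  \<open>[0, 1]\<close>; otherwise each nontrivial gap of the matching is bounded by an exploration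
  cost.\<close>

lemma expected_step_regret_le:
  assumes Astar: "distinct Astar" "set Astar = {1..K}" and n: "length (snd h) < n"
  shows "(\<integral>v. step_regret Astar (\<pi> h) (\<lambda>e. of_bool (v e)) \<partial>W)
    \<le> of_bool (unreliable h) + (\<integral>v. step_cost n h v \<partial>W)"
proof (cases "unreliable h")
  case True
  have "(\<integral>v. step_regret Astar (\<pi> h) (\<lambda>e. of_bool (v e)) \<partial>W) \<le> (\<integral>v. 1 + step_cost n h v \<partial>W)"
  proof (intro integral_mono integrable_weight_dist)
    fix v
    have "0 \<le> step_cost n h v"
      using n unfolding step_cost_def
      by (intro sum_nonneg mult_nonneg_nonneg exploration_cost_nonneg) auto
    then show "step_regret Astar (\<pi> h) (\<lambda>e. of_bool (v e)) \<le> 1 + step_cost n h v"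
      using reward_of_bool_bounds(2)[OF Astar(1), of v] reward_of_bool_bounds(1)[OF policy_distinct, of h v]
      by (simp add: step_regret_def)
  qed
  then show ?thesis
    using True by (simp add: integrable_weight_dist W.prob_space)
next
  case False
  let ?A = "\<pi> h" and ?p = "\<lambda>e. \<integral>v. of_bool (observed e (\<pi> h, click (\<pi> h) v)) \<partial>W"
  obtain \<sigma> where \<sigma>: "bij_betw \<sigma> (set ?A) {1..K}" "\<And>e. e \<in> set ?A \<Longrightarrow> e \<le> K \<Longrightarrow> \<sigma> e = e"
      "\<And>e. e \<in> set ?A \<Longrightarrow> e > K \<Longrightarrow> \<sigma> e \<in> {1..K} - set ?A"
    using perms_matching[OF policy_perms K_le_L] by blast
  have up: "wbar e \<le> wbar (\<sigma> e)" if "e \<in> set ?A" for e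
    using that \<sigma>(2,3)[of e] policy_subset[of h] wbar_mono[of "\<sigma> e" e] by (cases "e \<le> K") auto
  have "(\<integral>v. step_regret Astar ?A (\<lambda>e. of_bool (v e)) \<partial>W) = reward Astar wbar - reward ?A wbar"
    using integral_reward[OF Astar(1) _ wbar_bounds] integral_reward[OF policy_distinct policy_subset wbar_bounds]
      Astar(2) K_le_L
    by (simp add: step_regret_def integrable_weight_dist)
  also have "\<dots> \<le> (\<Sum>e\<in>set ?A. ?p e * (wbar (\<sigma> e) - wbar e))"
    by (rule reward_gap_le[OF Astar \<sigma>(1) up])
  \<comment> \<open>Recommended optimal items are matched with themselves and contribute 0.\<close>
  also have "\<dots> = (\<Sum>e\<in>set ?A \<inter> {K+1..L}. ?p e * (wbar (\<sigma> e) - wbar e))"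
  proof (rule sum.mono_neutral_right)
    show "\<forall>e\<in>set ?A - set ?A \<inter> {K+1..L}. ?p e * (wbar (\<sigma> e) - wbar e) = 0"
    proof
      fix e assume "e \<in> set ?A - set ?A \<inter> {K+1..L}"
      then have "e \<in> set ?A" "e \<le> K"
        using policy_subset[of h] by auto
      then show "?p e * (wbar (\<sigma> e) - wbar e) = 0"
        using \<sigma>(2) by simp
    qed
  qed auto
  also have "\<dots> \<le> (\<Sum>e\<in>set ?A \<inter> {K+1..L}. ?p e * exploration_cost n e (obs_count h e))"
    using False n \<sigma>(3)
    by (intro sum_mono mult_left_mono gap_le_exploration_cost integral_nonneg_AE) (auto simp: unreliable_def)
  also have "\<dots> \<le> (\<Sum>e\<in>{K+1..L}. ?p e * exploration_cost n e (obs_count h e))"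
    using n by (intro sum_mono2 mult_nonneg_nonneg exploration_cost_nonneg integral_nonneg_AE) auto
  also have "\<dots> = (\<integral>v. step_cost n h v \<partial>W)"
    unfolding step_cost_def
    by (simp add: integrable_weight_dist del: observed.simps sum_of_bool_mult_eq sum_mult_of_bool_eq)
  finally show ?thesis
    using False by simp
qed

subsection \<open>Cumulative regret\<close>

text \<open>With \<open>C = 6 * ln n\<close> the sum is at most
  \<open>2 * sqrt C * sqrt C / gap\<close>, hence the constant \<open>12 = 2 * 6\<close>.\<close>

lemma sum_exploration_cost_le:
  assumes "e \<in> {K+1..L}" "n \<ge> 1"
  shows "(\<Sum>s=1..<m. exploration_cost n e s) \<le> 12 / gap wbar e K * ln (real n)"
proof -
  let ?C = "6 * ln (real n)" and ?g = "gap wbar e K"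
  have C: "?C \<ge> 0" and g: "?g > 0"
    using assms gap_pos by auto
  have "(\<Sum>s=1..<m. exploration_cost n e s)
      = sqrt ?C * (\<Sum>s=1..<m. if real s \<le> ?C / ?g\<^sup>2 then 1 / sqrt (real s) else 0)"
    unfolding sum_distrib_left by (intro sum.cong) (auto simp: exploration_cost_def real_sqrt_divide)
  also have "\<dots> \<le> sqrt ?C * (2 * sqrt (?C / ?g\<^sup>2))"
    using C by (intro mult_left_mono sum_inverse_sqrt_le) auto
  also have "\<dots> = 2 * (sqrt ?C * sqrt ?C) / ?g"
    using g by (simp add: real_sqrt_divide)
  also have "\<dots> = 12 / ?g * ln (real n)"
    using C by (subst real_sqrt_mult_self) simp
  finally show ?thesis .
qed

text \<open>Holds on every single run: the counter of \<open>e\<close> starts at 1 and grows exactly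
  when \<open>e\<close> is charged.\<close>

lemma sum_step_cost_le:
  assumes "n \<ge> 1"
  shows "(\<Sum>t<n. step_cost n (H t \<omega>) (w (Suc t) \<omega>)) \<le> (\<Sum>e=K+1..L. 12 / gap wbar e K * ln (real n))"
proof -
  have "(\<Sum>t<n. step_cost n (H t \<omega>) (w (Suc t) \<omega>))
      = (\<Sum>e=K+1..L. \<Sum>t<n. of_bool (observed e (\<pi> (H t \<omega>), click (\<pi> (H t \<omega>)) (w (Suc t) \<omega>)))
          * exploration_cost n e (obs_count (H t \<omega>) e))"
    unfolding step_cost_def by (rule sum.swap)
  also have "\<dots> = (\<Sum>e=K+1..L. \<Sum>s=1..<obs_count (H n \<omega>) e. exploration_cost n e s)"
    by (intro sum.cong refl telescoping_cost obs_count_hist_0) (simp only: hist_Suc obs_count_extend)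
  also have "\<dots> \<le> (\<Sum>e=K+1..L. 12 / gap wbar e K * ln (real n))"
    using assms by (intro sum_mono sum_exploration_cost_le)
  finally show ?thesis .
qed

lemma expectation_unreliable_le:
  "expectation (\<lambda>\<omega>. of_bool (unreliable (H t \<omega>))) \<le> (if t < 2 then 1 else real L * (real (t + 1) / real t ^ 3))"
proof (cases "t < 2")
  case True
  then show ?thesis
    by (simp add: unreliable_def length_hist prob_space)
next
  case False
  have "expectation (\<lambda>\<omega>. of_bool (unreliable (H t \<omega>)))
      \<le> expectation (\<lambda>\<omega>. \<Sum>e=1..L. of_bool (misled (H t \<omega>) e) :: real)"
  proof (intro integral_mono integrable_H[where g = "\<lambda>h. of_bool (unreliable h)"]
      integrable_H[where g = "\<lambda>h. \<Sum>e=1..L. of_bool (misled h e)"])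
    fix \<omega>
    show "of_bool (unreliable (H t \<omega>)) \<le> (\<Sum>e=1..L. of_bool (misled (H t \<omega>) e) :: real)"
    proof (cases "unreliable (H t \<omega>)")
      case True
      then obtain e where "e \<in> {1..L}" "misled (H t \<omega>) e"
        using False by (auto simp: unreliable_def length_hist)
      then show ?thesis
        using member_le_sum[of e "{1..L}" "\<lambda>e. of_bool (misled (H t \<omega>) e) :: real"] by simp
    qed (simp add: sum_nonneg)
  qed
  also have "\<dots> = (\<Sum>e=1..L. expectation (\<lambda>\<omega>. of_bool (misled (H t \<omega>) e)))"
    by (intro Bochner_Integration.integral_sum integrable_H[where g = "\<lambda>h. of_bool (misled h _)"])
  also have "\<dots> \<le> (\<Sum>e=1..L. real (t + 1) / real t ^ 3)"
    using False by (intro sum_mono expectation_misled_le) auto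
  finally show ?thesis
    using False by simp
qed

lemma sum_unreliable_le:
  "(\<Sum>t<n. expectation (\<lambda>\<omega>. of_bool (unreliable (H t \<omega>)))) \<le> pi\<^sup>2 / 3 * real L"
proof -
  let ?b = "\<lambda>t. if t < 2 then 1 else real L * (real (t + 1) / real t ^ 3)"
  have "(\<Sum>t<n. expectation (\<lambda>\<omega>. of_bool (unreliable (H t \<omega>)))) \<le> (\<Sum>t<n. ?b t)"
    by (intro sum_mono expectation_unreliable_le)
  \<comment> \<open>Passing to \<open>n + 2\<close> guarantees that the first two terms are present
    and can be split off.\<close>
  also have "\<dots> \<le> (\<Sum>t<n + 2. ?b t)"
    by (intro sum_mono2) auto
  also have "{..<n + 2} = {..<2} \<union> {2..<n + 2}" by auto
  also have "sum ?b ({..<2} \<union> {2..<n + 2}) = 2 + real L * (\<Sum>t=2..<n + 2. real (t + 1) / real t ^ 3)"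
  proof -
    have "sum ?b {2..<n + 2} = real L * (\<Sum>t=2..<n + 2. real (t + 1) / real t ^ 3)"
      unfolding sum_distrib_left by (intro sum.cong) auto
    moreover have "sum ?b {..<2} = 2" by simp
    ultimately show ?thesis
      by (subst sum.union_disjoint) auto
  qed
  also have "\<dots> \<le> 2 + real L * (3 / 2 * (pi\<^sup>2 / 6 - 1))"
    by (intro add_left_mono mult_left_mono sum_cubic_tail_le) auto
  \<comment> \<open>After cancelling, the claim is
    \<open>2 \<le> L * (3 / 2 + pi\<^sup>2 / 12)\<close>, which follows from
    \<open>pi\<^sup>2 \<ge> 6\<close> and \<open>L \<ge> 1\<close>.\<close>
  also have "\<dots> \<le> pi\<^sup>2 / 3 * real L"
  proof -
    have "1 \<le> pi\<^sup>2 / 6"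
      using sum_le_suminf[of "\<lambda>n. 1 / (real n + 1)\<^sup>2" "{0}"] inverse_squares_sums
      by (auto simp: sums_iff add.commute)
    then have "2 \<le> 3 / 2 + pi\<^sup>2 / 12" by simp
    also have "\<dots> = 1 * (3 / 2 + pi\<^sup>2 / 12)" by simp
    also have "\<dots> \<le> real L * (3 / 2 + pi\<^sup>2 / 12)"
      using K_pos K_le_L by (intro mult_right_mono) auto
    finally show ?thesis
      by (simp add: algebra_simps)
  qed
  finally show ?thesis .
qed

text \<open>Each step is bounded with the fresh weights integrated out; the cost is then transferred
  back to the actual weights so that it can be summed run by run.\<close>

lemma expected_regret_le:
  assumes Astar: "distinct Astar" "set Astar = {1..K}" and n: "n \<ge> 1"
  shows "expected_regret M w \<pi> Astar n
    \<le> (\<Sum>e=K+1..L. 12 / gap wbar e K * ln (real n)) + pi\<^sup>2 / 3 * real L"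
proof -
  let ?R = "\<lambda>h v. step_regret Astar (\<pi> h) (\<lambda>e. of_bool (v e))"
  have step: "expectation (\<lambda>\<omega>. ?R (H t \<omega>) (w (Suc t) \<omega>))
      \<le> expectation (\<lambda>\<omega>. of_bool (unreliable (H t \<omega>))) + expectation (\<lambda>\<omega>. step_cost n (H t \<omega>) (w (Suc t) \<omega>))"
    if "t < n" for t
  proof -
    have "expectation (\<lambda>\<omega>. ?R (H t \<omega>) (w (Suc t) \<omega>)) = expectation (\<lambda>\<omega>. \<integral>v. ?R (H t \<omega>) v \<partial>W)"
      by (rule expectation_H_step[where g = ?R])
    also have "\<dots> \<le> expectation (\<lambda>\<omega>. of_bool (unreliable (H t \<omega>)) + (\<integral>v. step_cost n (H t \<omega>) v \<partial>W))"
      using that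
      by (intro integral_mono integrable_H[where g = "\<lambda>h. \<integral>v. ?R h v \<partial>W"]
          integrable_H[where g = "\<lambda>h. of_bool (unreliable h) + (\<integral>v. step_cost n h v \<partial>W)"]
          expected_step_regret_le Astar) (simp add: length_hist)
    also have "\<dots> = expectation (\<lambda>\<omega>. of_bool (unreliable (H t \<omega>))) + expectation (\<lambda>\<omega>. \<integral>v. step_cost n (H t \<omega>) v \<partial>W)"
      by (intro Bochner_Integration.integral_add integrable_H[where g = "\<lambda>h. of_bool (unreliable h)"]
          integrable_H[where g = "\<lambda>h. \<integral>v. step_cost n h v \<partial>W"])
    finally show ?thesis
      by (simp add: expectation_H_step)
  qed
  have "expected_regret M w \<pi> Astar n = expectation (\<lambda>\<omega>. \<Sum>t<n. ?R (H t \<omega>) (w (Suc t) \<omega>))"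
  proof -
    \<comment> \<open>Step \<open>t + 1\<close> is decided by the history after \<open>t\<close>
      steps, hence the shift of index.\<close>
    have "(\<Sum>t=1..n. f t) = (\<Sum>t<n. f (Suc t))" for f :: "nat \<Rightarrow> real"
      by (simp add: lessThan_atLeast0 sum.atLeast1_atMost_eq)
    then show ?thesis
      by (simp add: expected_regret_def action_def hist_def)
  qed
  also have "\<dots> = (\<Sum>t<n. expectation (\<lambda>\<omega>. ?R (H t \<omega>) (w (Suc t) \<omega>)))"
    by (intro Bochner_Integration.integral_sum integrable_H_step[where g = ?R])
  also have "\<dots> \<le> (\<Sum>t<n. expectation (\<lambda>\<omega>. of_bool (unreliable (H t \<omega>)))
      + expectation (\<lambda>\<omega>. step_cost n (H t \<omega>) (w (Suc t) \<omega>)))"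
    by (intro sum_mono step) simp
  also have "\<dots> = (\<Sum>t<n. expectation (\<lambda>\<omega>. of_bool (unreliable (H t \<omega>))))
      + expectation (\<lambda>\<omega>. \<Sum>t<n. step_cost n (H t \<omega>) (w (Suc t) \<omega>))"
    by (simp add: sum.distrib Bochner_Integration.integral_sum integrable_H_step[where g = "step_cost n"])
  also have "expectation (\<lambda>\<omega>. \<Sum>t<n. step_cost n (H t \<omega>) (w (Suc t) \<omega>))
      \<le> expectation (\<lambda>_. \<Sum>e=K+1..L. 12 / gap wbar e K * ln (real n))"
    by (intro integral_mono Bochner_Integration.integrable_sum integrable_H_step[where g = "step_cost n"]
        integrable_const sum_step_cost_le n)
  finally show ?thesis
    using sum_unreliable_le[of n] by (simp add: prob_space)
qed

end

section \<open>Optimal lists and the final bound\<close>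

text \<open>The matching replaces each item by one at least as attractive, so no list beats
  \<open>{1..K}\<close>. The product form of \<open>opt\<close> covers both
  \<open>[1..<Suc K]\<close> and a list in which a tied item replaces \<open>K\<close>.\<close>

lemma optimal_list:
  assumes KL: "K \<le> L"
    and wbar: "\<And>e. e \<in> {1..L} \<Longrightarrow> 0 \<le> wbar e \<and> wbar e \<le> 1"
    and decreasing: "\<And>i j. 1 \<le> i \<Longrightarrow> i \<le> j \<Longrightarrow> j \<le> L \<Longrightarrow> wbar j \<le> wbar i"
    and A: "A \<in> perms L K" and opt: "(\<Prod>e\<in>set A. 1 - wbar e) = (\<Prod>e\<in>{1..K}. 1 - wbar e)"
  shows "is_arg_max (\<lambda>A. reward A wbar) (\<lambda>A. A \<in> perms L K) A"
proof -
  have "reward B wbar \<le> reward A wbar" if B: "B \<in> perms L K" for B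
  proof -
    obtain \<sigma> where \<sigma>: "bij_betw \<sigma> (set B) {1..K}" "\<And>e. e \<in> set B \<Longrightarrow> e \<le> K \<Longrightarrow> \<sigma> e = e"
        "\<And>e. e \<in> set B \<Longrightarrow> e > K \<Longrightarrow> \<sigma> e \<in> {1..K} - set B"
      using perms_matching[OF B KL] by blast
    have BL: "set B \<subseteq> {1..L}" "distinct B" "distinct A"
      using A B by (auto simp: perms_def)
    have "(\<Prod>e\<in>{1..K}. 1 - wbar e) = (\<Prod>e\<in>set B. 1 - wbar (\<sigma> e))"
      by (rule prod.reindex_bij_betw[OF \<sigma>(1), symmetric])
    also have "\<dots> \<le> (\<Prod>e\<in>set B. 1 - wbar e)"
    proof (intro prod_mono)
      fix e assume e: "e \<in> set B"
      have "\<sigma> e \<in> {1..L}" using bij_betw_apply[OF \<sigma>(1) e] KL by auto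
      moreover have "wbar e \<le> wbar (\<sigma> e)"
        using e \<sigma>(2,3)[of e] BL decreasing[of "\<sigma> e" e] by (cases "e \<le> K") auto
      ultimately show "0 \<le> 1 - wbar (\<sigma> e) \<and> 1 - wbar (\<sigma> e) \<le> 1 - wbar e"
        using wbar by auto
    qed
    finally show ?thesis
      using opt BL by (simp add: reward_eq_prod)
  qed
  with A show ?thesis
    by (auto simp: is_arg_max_linorder)
qed

theorem theorem2:
  fixes M :: "'a measure" and w :: "nat \<Rightarrow> 'a \<Rightarrow> weights"
    and wbar :: "nat \<Rightarrow> real" and L K n :: nat
    and Astar :: "nat list" and \<pi> :: policy
  assumes "1 \<le> K" and "K \<le> L"
    and "\<And>e. e \<in> {1..L} \<Longrightarrow> 0 \<le> wbar e \<and> wbar e \<le> 1"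
    and "prob_space M"
    and iid: "prob_space.indep_vars M (\<lambda>_. weight_dist L wbar) w UNIV"
      "\<And>t. distr M (weight_dist L wbar) (w t) = weight_dist L wbar"
    and decreasing: "\<And>i j. 1 \<le> i \<Longrightarrow> i \<le> j \<Longrightarrow> j \<le> L \<Longrightarrow> wbar j \<le> wbar i"
    and optimal: "is_arg_max (\<lambda>A. reward A wbar) (\<lambda>A. A \<in> perms L K) Astar"
    and unique: "\<And>A. is_arg_max (\<lambda>A. reward A wbar) (\<lambda>A. A \<in> perms L K) A \<Longrightarrow> set A = set Astar"
    and "cascade_ucb1 L K \<pi>"
    and "n \<ge> 1"
  shows "expected_regret M w \<pi> Astar n
       \<le> (\<Sum>e=K+1..L. 12 / gap wbar e K * ln (real n)) + pi\<^sup>2 / 3 * real L"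
proof -
  note opt = optimal_list[OF assms(2,3) decreasing]
  have "is_arg_max (\<lambda>A. reward A wbar) (\<lambda>A. A \<in> perms L K) [1..<Suc K]"
    using assms(1,2) by (intro opt) (auto simp: perms_def atLeastLessThanSuc_atLeastAtMost simp del: upt_Suc)
  then have Astar: "set Astar = {1..K}"
    using unique by (metis set_upt atLeastLessThanSuc_atLeastAtMost)
  \<comment> \<open>An item tied with \<open>K\<close> could replace it, giving a second optimal
    set.\<close>
  have gap_pos: "gap wbar e K > 0" if e: "e \<in> {K+1..L}" for e
  proof (rule ccontr)
    assume "\<not> gap wbar e K > 0"
    then have eq: "wbar e = wbar K"
      using decreasing[of K e] e assms(1) by (auto simp: gap_def)
    define B where "B = [1..<K] @ [e]"
    have setB: "set B = insert e {1..<K}"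
      by (auto simp: B_def)
    have "{1..K} = insert K {1..<K}"
      using assms(1) by auto
    moreover have "(\<Prod>e\<in>insert f {1..<K}. 1 - wbar e) = (1 - wbar f) * (\<Prod>e\<in>{1..<K}. 1 - wbar e)"
      if "f \<ge> K" for f
      using that by (intro prod.insert) auto
    ultimately have "(\<Prod>e\<in>set B. 1 - wbar e) = (\<Prod>e\<in>{1..K}. 1 - wbar e)"
      using e eq unfolding setB by (metis add_leD1 atLeastAtMost_iff order.refl)
    then have "is_arg_max (\<lambda>A. reward A wbar) (\<lambda>A. A \<in> perms L K) B"
      using e assms(1) by (intro opt) (auto simp: perms_def B_def)
    then have "e \<in> {1..K}"
      using unique Astar setB by blast
    then show False
      using e by simp
  qed
  interpret cascade_bandit M w wbar L K \<pi>
    using assms gap_pos by (intro cascade_bandit.intro cascade_bandit_axioms.intro) auto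
  show ?thesis
    using optimal Astar assms(11) by (intro expected_regret_le) (auto simp: is_arg_max_def perms_def)
qed

end
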